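(* Let $\mathcal{H}_{\mathrm{s}}$ and $\mathcal{H}_{\mathrm{e}}$ be finite-dimensional complex Hilbert spaces of dimensions $n_{\mathrm{s}}$ and $n_{\mathrm{e}}$, let $\mathcal{H}_{\mathrm{c}} = \mathcal{H}_{\mathrm{s}} \otimes \mathcal{H}_{\mathrm{e}}$ and $n = n_{\mathrm{s}} n_{\mathrm{e}}$. Let $U \in \mathrm{U}(\mathcal{H}_{\mathrm{c}})$ and $V_{\mathrm{s}} \in \mathrm{U}(\mathcal{H}_{\mathrm{s}})$. Let $\mathcal{K}$ be the quantum channel on $\mathcal{H}_{\mathrm{s}}$ induced by $U$ with the environment initially in the maximally mixed state, and let $\mathcal{F}_{\mathrm{m,c}}(\mathcal{K}, V_{\mathrm{s}})$ be the corresponding channel fidelity. Then $$\left[ 1 - \tilde{\Delta}_{\mathrm{HS}}([U],[V_{\mathrm{s}} \otimes \mathbb{1}_{\mathrm{e}}]) \right]^{2} \leq \mathcal{F}_{\mathrm{m,c}}(\mathcal{K}, V_{\mathrm{s}}) \leq 1 - \tilde{\Delta}_{\mathrm{HS}}^{2}([U],[V_{\mathrm{s}} \otimes \mathbb{1}_{\mathrm{e}}]).$$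
   Context: $\mathrm{U}(\mathcal{H})$ is the group of unitary operators on $\mathcal{H}$; $\mathbb{1}_{\mathrm{s}}, \mathbb{1}_{\mathrm{e}}$ are the identity operators on $\mathcal{H}_{\mathrm{s}}, \mathcal{H}_{\mathrm{e}}$; $\mathrm{Tr}_{\mathrm{s}}$ and $\mathrm{Tr}_{\mathrm{e}}$ are the partial traces over $\mathcal{H}_{\mathrm{s}}$ and $\mathcal{H}_{\mathrm{e}}$; $\|M\|_{\mathrm{HS}} = \sqrt{\mathrm{Tr}(M^{\dagger}M)}$ is the Hilbert-Schmidt norm; $\|M\|_{\mathrm{Tr}} = \mathrm{Tr}(\sqrt{M^{\dagger} M})$ is the trace norm. Distance. For $U, V \in \mathrm{U}(\mathcal{H}_{\mathrm{c}})$, with $[U] = \{(\mathbb{1}_{\mathrm{s}} \otimes \Phi) U : \Phi \in \mathrm{U}(\mathcal{H}_{\mathrm{e}})\}$, $$\tilde{\Delta}_{\mathrm{HS}}([U],[V]) := \frac{1}{\sqrt{2n}} \min_{\Phi \in \mathrm{U}(\mathcal{H}_{\mathrm{e}})} \| U - (\mathbb{1}_{\mathrm{s}} \otimes \Phi) V \|_{\mathrm{HS}}.$$ For $V = V_{\mathrm{s}} \otimes \mathbb{1}_{\mathrm{e}}$ this equals $(1 - \frac{1}{n}\|\Gamma\|_{\mathrm{Tr}})^{1/2}$ with $\Gamma := \mathrm{Tr}_{\mathrm{s}}[U (V_{\mathrm{s}}^{\dagger} \otimes \mathbb{1}_{\mathrm{e}})]$, an operator on $\mathcal{H}_{\mathrm{e}}$.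 Channel and fidelity. The channel is $\mathcal{K}[\rho_{\mathrm{s}}] = \mathrm{Tr}_{\mathrm{e}}[U(\rho_{\mathrm{s}} \otimes \mathbb{1}_{\mathrm{e}}/n_{\mathrm{e}})U^{\dagger}]$. With an orthonormal basis $\{|\nu\rangle\}$ of $\mathcal{H}_{\mathrm{e}}$, it has the Kraus operators $K_{\nu\nu'} = n_{\mathrm{e}}^{-1/2}\, \mathrm{Tr}_{\mathrm{e}}[(\mathbb{1}_{\mathrm{s}} \otimes |\nu'\rangle\langle\nu|) U]$, $1 \le \nu,\nu' \le n_{\mathrm{e}}$. The fidelity with respect to $V_{\mathrm{s}}$ is $$\mathcal{F}_{\mathrm{m,c}}(\mathcal{K}, V_{\mathrm{s}}) := \frac{1}{n_{\mathrm{s}}^{2}} \sum_{\nu,\nu'} \left|\mathrm{Tr}(V_{\mathrm{s}}^{\dagger} K_{\nu\nu'})\right|^{2} = \frac{1}{n_{\mathrm{s}} n} \|\Gamma\|_{\mathrm{HS}}^{2}.$$ *)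

theory Defs
  imports "HOL-Analysis.Analysis"
begin

text \<open>
  An operator on an \<open>n\<close>-dimensional complex Hilbert space is its matrix in a fixed orthonormal basis,
  the index type having \<open>n\<close> elements. The system, the environment and the composite system carry the
  index types \<open>'s\<close>, \<open>'e\<close> and \<open>'s \<times> 'e\<close>, so the pairs index the product basis of the tensor product.
\<close>

type_synonym 'n cmat = "complex ^ 'n ^ 'n"

definition cadjoint :: "'n::finite cmat \<Rightarrow> 'n cmat" where
  "cadjoint A = (\<chi> i j. cnj (A $ j $ i))"

definition unitary :: "'n::finite cmat \<Rightarrow> bool" where
  "unitary A \<longleftrightarrow> cadjoint A ** A = mat 1 \<and> A ** cadjoint A = mat 1"

text \<open>The trace of \<open>M\<^sup>\<dagger>M\<close> is real and nonnegative, so taking its real part loses nothing.\<close>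

definition hs_norm :: "'n::finite cmat \<Rightarrow> real" where
  "hs_norm M = sqrt (Re (trace (cadjoint M ** M)))"

definition tensor :: "'s::finite cmat \<Rightarrow> 'e::finite cmat \<Rightarrow> ('s \<times> 'e) cmat" (infixr "\<otimes>\<^sub>c" 75) where
  "A \<otimes>\<^sub>c B = (\<chi> p q. A $ fst p $ fst q * B $ snd p $ snd q)"

definition ptrace_env :: "('s::finite \<times> 'e::finite) cmat \<Rightarrow> 's cmat" where
  "ptrace_env M = (\<chi> i j. \<Sum>k\<in>UNIV. M $ (i, k) $ (j, k))"

definition ketbra :: "complex ^ 'n \<Rightarrow> complex ^ 'n \<Rightarrow> 'n::finite cmat" where
  "ketbra x y = (\<chi> i j. x $ i * cnj (y $ j))"

text \<open>An orthonormal family indexed by \<open>'n\<close> has as many members as the dimension, so it is a basis.\<close>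

definition orthonormal_basis :: "('n::finite \<Rightarrow> complex ^ 'n) \<Rightarrow> bool" where
  "orthonormal_basis b \<longleftrightarrow>
     (\<forall>\<nu> \<nu>'. (\<Sum>k\<in>UNIV. cnj (b \<nu> $ k) * b \<nu>' $ k) = (if \<nu> = \<nu>' then 1 else 0))"

definition env_class :: "('s::finite \<times> 'e::finite) cmat \<Rightarrow> ('s \<times> 'e) cmat set" where
  "env_class U = {(mat 1 \<otimes>\<^sub>c \<Phi>) ** U | \<Phi>. unitary \<Phi>}"

text \<open>
  The distance is given by a formula in representatives of the two classes; the lemma
  \<open>env_dist_env_class\<close> below shows that the choice is immaterial. The infimum is a minimum, by
  \<open>env_min_attained\<close>.
\<close>

definition env_min :: "('s::finite \<times> 'e::finite) cmat \<Rightarrow> ('s \<times> 'e) cmat \<Rightarrow> real" where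
  "env_min U V = (INF \<Phi>\<in>{\<Phi> :: 'e cmat. unitary \<Phi>}. hs_norm (U - (mat 1 \<otimes>\<^sub>c \<Phi>) ** V))"

definition env_dist :: "('s::finite \<times> 'e::finite) cmat set \<Rightarrow> ('s \<times> 'e) cmat set \<Rightarrow> real" where
  "env_dist X Y = (THE d. \<exists>U\<in>X. \<exists>V\<in>Y. d = 1 / sqrt (2 * real (CARD('s) * CARD('e))) * env_min U V)"

definition env_channel :: "('s::finite \<times> 'e::finite) cmat \<Rightarrow> 's cmat \<Rightarrow> 's cmat" where
  "env_channel U \<rho> = ptrace_env (U ** (\<rho> \<otimes>\<^sub>c mat (1 / of_nat CARD('e))) ** cadjoint U)"

definition env_kraus ::
    "('s::finite \<times> 'e::finite) cmat \<Rightarrow> ('e \<Rightarrow> complex ^ 'e) \<Rightarrow> 'e \<Rightarrow> 'e \<Rightarrow> 's cmat" where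
  "env_kraus U b \<nu> \<nu>' =
     mat (1 / of_real (sqrt (real CARD('e)))) ** ptrace_env ((mat 1 \<otimes>\<^sub>c ketbra (b \<nu>') (b \<nu>)) ** U)"

definition is_kraus :: "('s::finite cmat \<Rightarrow> 's cmat) \<Rightarrow> 's cmat list \<Rightarrow> bool" where
  "is_kraus \<K> Ks \<longleftrightarrow> (\<forall>\<rho>. \<K> \<rho> = (\<Sum>A\<leftarrow>Ks. A ** \<rho> ** cadjoint A))"

text \<open>
  The fidelity of a channel is given by a formula in Kraus operators of the channel. All Kraus
  representations give the same value (\<open>channel_fidelity_kraus\<close>); for the channel induced by \<open>U\<close>
  it is the sum over the operators \<open>env_kraus U b \<nu> \<nu>'\<close>, for every orthonormal basis \<open>b\<close> of the
  environment (\<open>channel_fidelity_env_channel\<close>).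
\<close>

definition channel_fidelity :: "('s::finite cmat \<Rightarrow> 's cmat) \<Rightarrow> 's cmat \<Rightarrow> real" where
  "channel_fidelity \<K> V =
     (THE f. \<exists>Ks. is_kraus \<K> Ks \<and>
        f = 1 / (real CARD('s))\<^sup>2 * (\<Sum>A\<leftarrow>Ks. (cmod (trace (cadjoint V ** A)))\<^sup>2))"


subsection \<open>Well-definedness of the distance\<close>

lemma cadjoint_mult: "cadjoint (A ** B) = cadjoint B ** cadjoint A"
  by (simp add: cadjoint_def matrix_matrix_mult_def vec_eq_iff mult.commute)

lemma cadjoint_cadjoint [simp]: "cadjoint (cadjoint A) = A"
  by (simp add: cadjoint_def vec_eq_iff)

lemma cadjoint_mat_1 [simp]: "cadjoint (mat 1) = mat 1"
  by (simp add: cadjoint_def mat_def vec_eq_iff)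

lemma cadjoint_tensor: "cadjoint (A \<otimes>\<^sub>c B) = cadjoint A \<otimes>\<^sub>c cadjoint B"
  by (simp add: cadjoint_def tensor_def vec_eq_iff)

lemma tensor_mult: "(A \<otimes>\<^sub>c B) ** (C \<otimes>\<^sub>c D) = (A ** C) \<otimes>\<^sub>c (B ** D)"
  by (simp add: tensor_def matrix_matrix_mult_def vec_eq_iff sum_product
      sum.cartesian_product case_prod_beta flip: UNIV_Times_UNIV)
     (simp add: mult_ac)

lemma tensor_mat_1 [simp]: "mat 1 \<otimes>\<^sub>c mat 1 = mat 1"
  by (simp add: tensor_def mat_def vec_eq_iff prod_eq_iff)

lemma unitary_mat_1 [simp]: "unitary (mat 1)"
  by (simp add: unitary_def)

lemma unitary_cadjoint: "unitary A \<Longrightarrow> unitary (cadjoint A)"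
  by (simp add: unitary_def)

lemma unitary_mult:
  assumes "unitary A" "unitary B"
  shows "unitary (A ** B)"
proof -
  have "cadjoint (A ** B) ** (A ** B) = cadjoint B ** (cadjoint A ** A) ** B"
    by (simp add: cadjoint_mult matrix_mul_assoc)
  moreover have "(A ** B) ** cadjoint (A ** B) = A ** (B ** cadjoint B) ** cadjoint A"
    by (simp add: cadjoint_mult matrix_mul_assoc)
  ultimately show ?thesis
    using assms by (simp add: unitary_def)
qed

lemma unitary_tensor: "unitary A \<Longrightarrow> unitary B \<Longrightarrow> unitary (A \<otimes>\<^sub>c B)"
  by (simp add: unitary_def cadjoint_tensor tensor_mult)

lemma trace_cadjoint_mult_self:
  "trace (cadjoint M ** M) = of_real (\<Sum>j\<in>UNIV. \<Sum>i\<in>UNIV. (cmod (M $ i $ j))\<^sup>2)"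
  by (simp add: trace_def cadjoint_def matrix_matrix_mult_def complex_norm_square mult.commute
      flip: of_real_power)

lemma hs_norm_eq_norm: "hs_norm M = norm M"
proof -
  have "(\<Sum>j\<in>UNIV. \<Sum>i\<in>UNIV. (cmod (M $ i $ j))\<^sup>2) = (\<Sum>i\<in>UNIV. \<Sum>j\<in>UNIV. (cmod (M $ i $ j))\<^sup>2)"
    by (rule sum.swap)
  thus ?thesis
    by (simp add: hs_norm_def trace_cadjoint_mult_self norm_vec_def L2_set_def sum_nonneg)
qed

lemma matrix_mult_diff_right:
  fixes A :: "'n::finite cmat"
  shows "A ** (B - C) = A ** B - A ** C"
  by (simp add: matrix_matrix_mult_def vec_eq_iff right_diff_distrib sum_subtractf)

lemma hs_norm_unitary_mult:
  assumes "unitary W"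
  shows "hs_norm (W ** M) = hs_norm M"
proof -
  have "cadjoint (W ** M) ** (W ** M) = cadjoint M ** (cadjoint W ** W) ** M"
    by (simp add: cadjoint_mult matrix_mul_assoc)
  thus ?thesis
    using assms by (simp add: hs_norm_def unitary_def)
qed

lemma env_min_attained:
  fixes U V :: "('s::finite \<times> 'e::finite) cmat"
  shows "\<exists>\<Phi> :: 'e cmat. unitary \<Phi> \<and> hs_norm (U - (mat 1 \<otimes>\<^sub>c \<Phi>) ** V) = env_min U V \<and>
           (\<forall>\<Psi>. unitary \<Psi> \<longrightarrow> env_min U V \<le> hs_norm (U - (mat 1 \<otimes>\<^sub>c \<Psi>) ** V))"
proof -
  let ?S = "{\<Phi> :: 'e cmat. unitary \<Phi>}"
  let ?f = "\<lambda>\<Phi> :: 'e cmat. hs_norm (U - (mat 1 \<otimes>\<^sub>c \<Phi>) ** V)"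
  have "norm \<Phi> = sqrt (Re (trace (mat 1 :: 'e cmat)))" if "unitary \<Phi>" for \<Phi> :: "'e cmat"
    using that by (simp flip: hs_norm_eq_norm add: hs_norm_def unitary_def)
  hence bdd: "bounded ?S"
    unfolding bounded_iff by (metis mem_Collect_eq order_refl)
  have "closed ?S"
    unfolding unitary_def cadjoint_def matrix_matrix_mult_def
    by (intro closed_Collect_conj closed_Collect_eq continuous_intros)
  with bdd have "compact ?S"
    by (simp add: compact_eq_bounded_closed)
  moreover have "?S \<noteq> {}"
    using unitary_mat_1 by blast
  moreover have "continuous_on ?S ?f"
    unfolding hs_norm_eq_norm tensor_def matrix_matrix_mult_def
    by (intro continuous_intros)
  ultimately obtain \<Phi> where \<Phi>: "\<Phi> \<in> ?S" "\<forall>\<Psi>\<in>?S. ?f \<Phi> \<le> ?f \<Psi>"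
    using continuous_attains_inf by blast
  have "env_min U V = ?f \<Phi>"
    unfolding env_min_def using \<Phi> by (intro cInf_eq_minimum) auto
  with \<Phi> show ?thesis
    by auto
qed

lemma env_min_representatives:
  fixes A B :: "'e::finite cmat" and U V :: "('s::finite \<times> 'e) cmat"
  assumes "unitary A" "unitary B"
  shows "env_min ((mat 1 \<otimes>\<^sub>c A) ** U) ((mat 1 \<otimes>\<^sub>c B) ** V) = env_min U V"
proof -
  let ?g = "\<lambda>\<Phi> :: 'e cmat. cadjoint A ** \<Phi> ** B"
  let ?S = "{\<Phi> :: 'e cmat. unitary \<Phi>}"
  have AB: "A ** cadjoint A = mat 1" "B ** cadjoint B = mat 1"
    "cadjoint A ** A = mat 1" "cadjoint B ** B = mat 1"
    using assms by (auto simp: unitary_def)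
  have g_image: "?g ` ?S = ?S"
  proof
    show "?g ` ?S \<subseteq> ?S"
      using assms by (auto intro!: unitary_mult unitary_cadjoint)
    show "?S \<subseteq> ?g ` ?S"
    proof
      fix \<Psi> :: "'e cmat"
      assume "\<Psi> \<in> ?S"
      hence "A ** \<Psi> ** cadjoint B \<in> ?S"
        using assms by (auto intro!: unitary_mult unitary_cadjoint)
      moreover have "?g (A ** \<Psi> ** cadjoint B) = (cadjoint A ** A) ** \<Psi> ** (cadjoint B ** B)"
        by (simp only: matrix_mul_assoc)
      ultimately show "\<Psi> \<in> ?g ` ?S"
        by (intro image_eqI[where x = "A ** \<Psi> ** cadjoint B"]) (simp_all add: AB)
    qed
  qed
  have norm_eq: "hs_norm ((mat 1 \<otimes>\<^sub>c A) ** U - (mat 1 \<otimes>\<^sub>c \<Phi>) ** ((mat 1 \<otimes>\<^sub>c B) ** V))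
      = hs_norm (U - (mat 1 \<otimes>\<^sub>c ?g \<Phi>) ** V)" for \<Phi>
  proof -
    have "(mat 1 \<otimes>\<^sub>c A) ** (U - (mat 1 \<otimes>\<^sub>c ?g \<Phi>) ** V)
        = (mat 1 \<otimes>\<^sub>c A) ** U - ((mat 1 \<otimes>\<^sub>c A) ** (mat 1 \<otimes>\<^sub>c ?g \<Phi>)) ** V"
      by (simp add: matrix_mult_diff_right matrix_mul_assoc)
    also have "(mat 1 \<otimes>\<^sub>c A) ** (mat 1 \<otimes>\<^sub>c ?g \<Phi>) = (mat 1 \<otimes>\<^sub>c ((A ** cadjoint A) ** \<Phi> ** B) :: ('s \<times> 'e) cmat)"
      by (simp add: tensor_mult matrix_mul_assoc)
    also have "\<dots> = (mat 1 \<otimes>\<^sub>c \<Phi>) ** (mat 1 \<otimes>\<^sub>c B)"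
      by (simp add: tensor_mult AB)
    finally show ?thesis
      using hs_norm_unitary_mult[OF unitary_tensor[OF unitary_mat_1 assms(1)],
        of "U - (mat 1 \<otimes>\<^sub>c ?g \<Phi>) ** V"]
      by (simp add: matrix_mul_assoc)
  qed
  let ?h = "\<lambda>\<Phi> :: 'e cmat. hs_norm (U - (mat 1 \<otimes>\<^sub>c \<Phi>) ** V)"
  have "env_min ((mat 1 \<otimes>\<^sub>c A) ** U) ((mat 1 \<otimes>\<^sub>c B) ** V) = Inf ((\<lambda>\<Phi>. ?h (?g \<Phi>)) ` ?S)"
    unfolding env_min_def norm_eq ..
  also have "(\<lambda>\<Phi>. ?h (?g \<Phi>)) ` ?S = ?h ` ?g ` ?S"
    by (simp only: image_image)
  finally show ?thesis
    unfolding g_image env_min_def .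
qed

lemma env_dist_env_class:
  fixes U V :: "('s::finite \<times> 'e::finite) cmat"
  shows "env_dist (env_class U) (env_class V) =
           1 / sqrt (2 * real (CARD('s) * CARD('e))) * env_min U V"
proof -
  let ?d = "\<lambda>U V :: ('s \<times> 'e) cmat. 1 / sqrt (2 * real (CARD('s) * CARD('e))) * env_min U V"
  have "W \<in> env_class W" for W :: "('s \<times> 'e) cmat"
  proof -
    have "W = (mat 1 \<otimes>\<^sub>c (mat 1 :: 'e cmat)) ** W"
      by simp
    thus ?thesis
      unfolding env_class_def using unitary_mat_1 by blast
  qed
  hence ex: "\<exists>U'\<in>env_class U. \<exists>V'\<in>env_class V. ?d U V = ?d U' V'"
    by blast
  have eq: "env_min U' V' = env_min U V" if U': "U' \<in> env_class U" and V': "V' \<in> env_class V" for U' V'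
  proof -
    obtain A where "unitary A" "U' = (mat 1 \<otimes>\<^sub>c A) ** U"
      using U' by (auto simp: env_class_def)
    moreover obtain B where "unitary B" "V' = (mat 1 \<otimes>\<^sub>c B) ** V"
      using V' by (auto simp: env_class_def)
    ultimately show ?thesis
      by (simp only: env_min_representatives)
  qed
  show ?thesis
    unfolding env_dist_def
  proof (rule the_equality)
    show "\<exists>U'\<in>env_class U. \<exists>V'\<in>env_class V. ?d U V = ?d U' V'"
      by (rule ex)
  next
    fix d
    assume "\<exists>U'\<in>env_class U. \<exists>V'\<in>env_class V. d = ?d U' V'"
    then obtain U' V' where "U' \<in> env_class U" "V' \<in> env_class V" "d = ?d U' V'"
      by blast
    thus "d = ?d U V"
      by (simp only: eq)
  qed
qed


subsection \<open>Well-definedness of the fidelity\<close>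

lemma kraus_fidelity_sum:
  fixes \<K> :: "'s::finite cmat \<Rightarrow> 's cmat"
  assumes "is_kraus \<K> Ks"
  shows "complex_of_real (\<Sum>A\<leftarrow>Ks. (cmod (trace (cadjoint V ** A)))\<^sup>2) =
    (\<Sum>j\<in>UNIV. \<Sum>l\<in>UNIV. \<Sum>i\<in>UNIV. \<Sum>k\<in>UNIV.
       cnj (V $ i $ j) * V $ k $ l * \<K> (\<chi> a b. if a = j \<and> b = l then 1 else 0) $ i $ k)"
proof -
  define E :: "'s \<Rightarrow> 's \<Rightarrow> 's cmat" where "E = (\<lambda>j l. \<chi> a b. if a = j \<and> b = l then 1 else 0)"
  have E: "(A ** E j l ** cadjoint A) $ i $ k = A $ i $ j * cnj (A $ k $ l)" for A i j k l
  proof -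
    have "(A ** E j l) $ i $ m = (if m = l then A $ i $ j else 0)" for m
      by (auto simp: matrix_matrix_mult_def E_def if_distrib cong: if_cong)
    hence "(A ** E j l ** cadjoint A) $ i $ k =
        (\<Sum>m\<in>UNIV. if m = l then A $ i $ j * cnj (A $ k $ l) else 0)"
      unfolding matrix_matrix_mult_def[of "A ** E j l"] vec_lambda_beta
      by (intro sum.cong) (simp_all add: cadjoint_def)
    thus ?thesis
      by simp
  qed
  have one: "complex_of_real ((cmod (trace (cadjoint V ** A)))\<^sup>2) =
    (\<Sum>j\<in>UNIV. \<Sum>l\<in>UNIV. \<Sum>i\<in>UNIV. \<Sum>k\<in>UNIV.
       cnj (V $ i $ j) * V $ k $ l * (A ** E j l ** cadjoint A) $ i $ k)" for A
  proof -
    have tr: "trace (cadjoint V ** A) = (\<Sum>j\<in>UNIV. \<Sum>i\<in>UNIV. cnj (V $ i $ j) * A $ i $ j)"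
      by (simp add: trace_def cadjoint_def matrix_matrix_mult_def)
    have "complex_of_real ((cmod (trace (cadjoint V ** A)))\<^sup>2) =
        trace (cadjoint V ** A) * cnj (trace (cadjoint V ** A))"
      by (simp add: complex_norm_square flip: of_real_power)
    thus ?thesis
      unfolding tr E by (simp add: sum_product mult_ac)
  qed
  have "\<K> \<rho> $ i $ k = (\<Sum>A\<leftarrow>Ks. (A ** \<rho> ** cadjoint A) $ i $ k)" for \<rho> i k
  proof -
    have "(\<Sum>A\<leftarrow>As. A ** \<rho> ** cadjoint A) $ i $ k = (\<Sum>A\<leftarrow>As. (A ** \<rho> ** cadjoint A) $ i $ k)" for As
      by (induction As) simp_all
    thus ?thesis
      using assms by (simp add: is_kraus_def)
  qed
  moreover have "complex_of_real (\<Sum>A\<leftarrow>As. (cmod (trace (cadjoint V ** A)))\<^sup>2) =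
    (\<Sum>j\<in>UNIV. \<Sum>l\<in>UNIV. \<Sum>i\<in>UNIV. \<Sum>k\<in>UNIV.
       cnj (V $ i $ j) * V $ k $ l * (\<Sum>A\<leftarrow>As. (A ** E j l ** cadjoint A) $ i $ k))" for As
  proof (induction As)
    case (Cons A As)
    show ?case
      unfolding list.map sum_list.Cons of_real_add one Cons.IH
      by (simp only: distrib_left sum.distrib)
  qed simp
  ultimately show ?thesis
    by (simp add: E_def)
qed

lemma channel_fidelity_kraus:
  fixes \<K> :: "'s::finite cmat \<Rightarrow> 's cmat"
  assumes "is_kraus \<K> Ks"
  shows "channel_fidelity \<K> V =
           1 / (real CARD('s))\<^sup>2 * (\<Sum>A\<leftarrow>Ks. (cmod (trace (cadjoint V ** A)))\<^sup>2)"
proof -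
  let ?f = "\<lambda>Ks. \<Sum>A\<leftarrow>Ks. (cmod (trace (cadjoint V ** A)))\<^sup>2"
  have eq: "?f Ks' = ?f Ks" if "is_kraus \<K> Ks'" for Ks'
  proof -
    have "complex_of_real (?f Ks') = complex_of_real (?f Ks)"
      by (rule trans[OF kraus_fidelity_sum[OF that] kraus_fidelity_sum[OF assms, symmetric]])
    thus ?thesis
      by (simp only: of_real_eq_iff)
  qed
  show ?thesis
    unfolding channel_fidelity_def
  proof (rule the_equality)
    show "\<exists>Ks'. is_kraus \<K> Ks' \<and> 1 / (real CARD('s))\<^sup>2 * ?f Ks = 1 / (real CARD('s))\<^sup>2 * ?f Ks'"
      using assms by blast
  next
    fix f
    assume "\<exists>Ks'. is_kraus \<K> Ks' \<and> f = 1 / (real CARD('s))\<^sup>2 * ?f Ks'"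
    then obtain Ks' where "is_kraus \<K> Ks'" "f = 1 / (real CARD('s))\<^sup>2 * ?f Ks'"
      by blast
    thus "f = 1 / (real CARD('s))\<^sup>2 * ?f Ks"
      by (simp only: eq)
  qed
qed

lemma orthonormal_basis_complete:
  fixes b :: "'n::finite \<Rightarrow> complex ^ 'n"
  assumes "orthonormal_basis b"
  shows "(\<Sum>\<nu>\<in>UNIV. b \<nu> $ k * cnj (b \<nu> $ l)) = (if k = l then 1 else 0)"
proof -
  define B :: "'n cmat" where "B = (\<chi> i \<nu>. b \<nu> $ i)"
  have "cadjoint B ** B = mat 1"
    using assms
    by (simp add: orthonormal_basis_def B_def cadjoint_def matrix_matrix_mult_def mat_def vec_eq_iff)
  hence "B ** cadjoint B = mat 1"
    by (rule matrix_left_right_inverse[THEN iffD1])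
  hence "(B ** cadjoint B) $ k $ l = mat 1 $ k $ l"
    by simp
  thus ?thesis
    by (simp add: B_def cadjoint_def matrix_matrix_mult_def mat_def)
qed

lemma orthonormal_basis_parseval:
  fixes b :: "'n::finite \<Rightarrow> complex ^ 'n"
  assumes "orthonormal_basis b"
  shows "(\<Sum>\<nu>\<in>UNIV. (\<Sum>k\<in>UNIV. b \<nu> $ k * f k) * (\<Sum>l\<in>UNIV. cnj (b \<nu> $ l) * g l)) =
           (\<Sum>k\<in>UNIV. f k * g k)"
proof -
  have "(\<Sum>\<nu>\<in>UNIV. (\<Sum>k\<in>UNIV. b \<nu> $ k * f k) * (\<Sum>l\<in>UNIV. cnj (b \<nu> $ l) * g l)) =
      (\<Sum>\<nu>\<in>UNIV. \<Sum>k\<in>UNIV. \<Sum>l\<in>UNIV. f k * g l * (b \<nu> $ k * cnj (b \<nu> $ l)))"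
    by (simp add: sum_product mult_ac)
  also have "\<dots> = (\<Sum>k\<in>UNIV. \<Sum>\<nu>\<in>UNIV. \<Sum>l\<in>UNIV. f k * g l * (b \<nu> $ k * cnj (b \<nu> $ l)))"
    by (rule sum.swap)
  also have "\<dots> = (\<Sum>k\<in>UNIV. \<Sum>l\<in>UNIV. \<Sum>\<nu>\<in>UNIV. f k * g l * (b \<nu> $ k * cnj (b \<nu> $ l)))"
    by (intro sum.cong refl sum.swap)
  also have "\<dots> = (\<Sum>k\<in>UNIV. \<Sum>l\<in>UNIV. f k * g l * (if k = l then 1 else 0))"
    by (simp only: orthonormal_basis_complete[OF assms] flip: sum_distrib_left)
  also have "\<dots> = (\<Sum>k\<in>UNIV. f k * g k)"
    by (simp add: if_distrib cong: if_cong)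
  finally show ?thesis .
qed

lemma mat_mult_nth: "(mat c ** A) $ i $ j = c * A $ i $ j"
  by (simp add: matrix_matrix_mult_def mat_def if_distrib if_distribR cong: if_cong)

lemma triple_mult_nth:
  "(A ** B ** C) $ i $ j = (\<Sum>k\<in>UNIV. \<Sum>l\<in>UNIV. A $ i $ k * B $ k $ l * C $ l $ j)"
  by (simp add: matrix_matrix_mult_def sum_distrib_right) (rule sum.swap)

lemma sum_UNIV_prod:
  fixes f :: "'s::finite \<times> 'e::finite \<Rightarrow> 'z::comm_monoid_add"
  shows "(\<Sum>p\<in>UNIV. f p) = (\<Sum>i\<in>UNIV. \<Sum>k\<in>UNIV. f (i, k))"
  by (simp add: sum.cartesian_product)

lemma env_kraus_nth:
  fixes U :: "('s::finite \<times> 'e::finite) cmat"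
  shows "env_kraus U b \<nu> \<nu>' $ i $ j = 1 / of_real (sqrt (real CARD('e))) *
           (\<Sum>k\<in>UNIV. b \<nu>' $ k * (\<Sum>l\<in>UNIV. cnj (b \<nu> $ l) * U $ (i, l) $ (j, k)))"
proof -
  have "((mat 1 \<otimes>\<^sub>c ketbra (b \<nu>') (b \<nu>)) ** U) $ (i, k) $ (j, k) =
      b \<nu>' $ k * (\<Sum>l\<in>UNIV. cnj (b \<nu> $ l) * U $ (i, l) $ (j, k))" for k
  proof -
    have "((mat 1 \<otimes>\<^sub>c ketbra (b \<nu>') (b \<nu>)) ** U) $ (i, k) $ (j, k) =
        (\<Sum>m\<in>UNIV. if m = i
           then b \<nu>' $ k * (\<Sum>l\<in>UNIV. cnj (b \<nu> $ l) * U $ (i, l) $ (j, k)) else 0)"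
      unfolding matrix_matrix_mult_def tensor_def ketbra_def mat_def vec_lambda_beta sum_UNIV_prod
      by (intro sum.cong) (auto simp: sum_distrib_left mult_ac)
    thus ?thesis
      by simp
  qed
  thus ?thesis
    by (simp add: env_kraus_def mat_mult_nth ptrace_env_def)
qed

lemma env_channel_nth:
  fixes U :: "('s::finite \<times> 'e::finite) cmat"
  shows "env_channel U \<rho> $ i $ i' = 1 / of_nat CARD('e) * (\<Sum>j\<in>UNIV. \<Sum>j'\<in>UNIV. \<rho> $ j $ j' *
           (\<Sum>l\<in>UNIV. \<Sum>k\<in>UNIV. U $ (i, l) $ (j, k) * cnj (U $ (i', l) $ (j', k))))"
proof -
  have inner: "(\<Sum>k'\<in>UNIV. U $ (i, l) $ (j, k) * (\<rho> \<otimes>\<^sub>c mat (1 / of_nat CARD('e))) $ (j, k) $ (j', k')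
          * cadjoint U $ (j', k') $ (i', l)) =
      1 / of_nat CARD('e) * (\<rho> $ j $ j' * (U $ (i, l) $ (j, k) * cnj (U $ (i', l) $ (j', k))))"
    for j k j' l
  proof -
    have "(\<Sum>k'\<in>UNIV. U $ (i, l) $ (j, k) * (\<rho> \<otimes>\<^sub>c mat (1 / of_nat CARD('e))) $ (j, k) $ (j', k')
          * cadjoint U $ (j', k') $ (i', l)) =
        (\<Sum>k'\<in>UNIV. if k' = k then 1 / of_nat CARD('e) *
          (\<rho> $ j $ j' * (U $ (i, l) $ (j, k) * cnj (U $ (i', l) $ (j', k)))) else 0)"
      by (intro sum.cong) (auto simp: tensor_def mat_def cadjoint_def)
    thus ?thesis
      by simp
  qed
  let ?t = "\<lambda>l j k j'. \<rho> $ j $ j' * (U $ (i, l) $ (j, k) * cnj (U $ (i', l) $ (j', k)))"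
  have "env_channel U \<rho> $ i $ i' = (\<Sum>l\<in>UNIV. \<Sum>j\<in>UNIV. \<Sum>k\<in>UNIV. \<Sum>j'\<in>UNIV. 1 / of_nat CARD('e) * ?t l j k j')"
    unfolding env_channel_def ptrace_env_def vec_lambda_beta triple_mult_nth sum_UNIV_prod inner ..
  also have "\<dots> = 1 / of_nat CARD('e) * (\<Sum>l\<in>UNIV. \<Sum>j\<in>UNIV. \<Sum>k\<in>UNIV. \<Sum>j'\<in>UNIV. ?t l j k j')"
    by (simp only: sum_distrib_left)
  also have "(\<Sum>l\<in>UNIV. \<Sum>j\<in>UNIV. \<Sum>k\<in>UNIV. \<Sum>j'\<in>UNIV. ?t l j k j') =
      (\<Sum>l\<in>UNIV. \<Sum>j\<in>UNIV. \<Sum>j'\<in>UNIV. \<Sum>k\<in>UNIV. ?t l j k j')"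
    by (intro sum.cong refl sum.swap)
  also have "\<dots> = (\<Sum>j\<in>UNIV. \<Sum>l\<in>UNIV. \<Sum>j'\<in>UNIV. \<Sum>k\<in>UNIV. ?t l j k j')"
    by (rule sum.swap)
  also have "\<dots> = (\<Sum>j\<in>UNIV. \<Sum>j'\<in>UNIV. \<Sum>l\<in>UNIV. \<Sum>k\<in>UNIV. ?t l j k j')"
    by (intro sum.cong refl sum.swap)
  finally show ?thesis
    by (simp only: sum_distrib_left)
qed

lemma env_channel_kraus:
  fixes U :: "('s::finite \<times> 'e::finite) cmat"
  assumes "orthonormal_basis b"
  shows "env_channel U \<rho> = (\<Sum>\<nu>\<in>UNIV. \<Sum>\<nu>'\<in>UNIV. env_kraus U b \<nu> \<nu>' ** \<rho> ** cadjoint (env_kraus U b \<nu> \<nu>'))"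
proof -
  let ?c = "1 / complex_of_real (sqrt (real CARD('e)))"
  have c: "?c * ?c = 1 / of_nat CARD('e)"
    by (simp flip: of_real_mult)
  have K: "(\<Sum>\<nu>\<in>UNIV. \<Sum>\<nu>'\<in>UNIV. env_kraus U b \<nu> \<nu>' $ i $ j * cnj (env_kraus U b \<nu> \<nu>' $ i' $ j')) =
      1 / of_nat CARD('e) *
        (\<Sum>l\<in>UNIV. \<Sum>k\<in>UNIV. U $ (i, l) $ (j, k) * cnj (U $ (i', l) $ (j', k)))" for i i' j j'
  proof -
    define f where "f = (\<lambda>\<nu> k. \<Sum>l\<in>UNIV. cnj (b \<nu> $ l) * U $ (i, l) $ (j, k))"
    define g where "g = (\<lambda>\<nu> k. \<Sum>l\<in>UNIV. b \<nu> $ l * cnj (U $ (i', l) $ (j', k)))"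
    have KK: "env_kraus U b \<nu> \<nu>' $ i $ j * cnj (env_kraus U b \<nu> \<nu>' $ i' $ j') =
        ?c * ?c * ((\<Sum>k\<in>UNIV. b \<nu>' $ k * f \<nu> k) * (\<Sum>k\<in>UNIV. cnj (b \<nu>' $ k) * g \<nu> k))" for \<nu> \<nu>'
      by (simp add: env_kraus_nth f_def g_def)
    have "(\<Sum>\<nu>\<in>UNIV. \<Sum>\<nu>'\<in>UNIV. env_kraus U b \<nu> \<nu>' $ i $ j * cnj (env_kraus U b \<nu> \<nu>' $ i' $ j')) =
        1 / of_nat CARD('e) * (\<Sum>\<nu>\<in>UNIV. \<Sum>k\<in>UNIV. f \<nu> k * g \<nu> k)"
      unfolding KK c by (simp only: orthonormal_basis_parseval[OF assms] flip: sum_distrib_left)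
    also have "(\<Sum>\<nu>\<in>UNIV. \<Sum>k\<in>UNIV. f \<nu> k * g \<nu> k) = (\<Sum>k\<in>UNIV. \<Sum>\<nu>\<in>UNIV. g \<nu> k * f \<nu> k)"
      by (subst sum.swap) (simp only: mult.commute)
    also have "\<dots> = (\<Sum>k\<in>UNIV. \<Sum>l\<in>UNIV. cnj (U $ (i', l) $ (j', k)) * U $ (i, l) $ (j, k))"
      unfolding f_def g_def orthonormal_basis_parseval[OF assms] ..
    also have "\<dots> = (\<Sum>l\<in>UNIV. \<Sum>k\<in>UNIV. U $ (i, l) $ (j, k) * cnj (U $ (i', l) $ (j', k)))"
      by (subst sum.swap) (simp only: mult.commute)
    finally show ?thesis .
  qed
  have "(\<Sum>\<nu>\<in>UNIV. \<Sum>\<nu>'\<in>UNIV. env_kraus U b \<nu> \<nu>' ** \<rho> ** cadjoint (env_kraus U b \<nu> \<nu>')) $ i $ i'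
      = env_channel U \<rho> $ i $ i'" for i i'
  proof -
    let ?t = "\<lambda>\<nu> \<nu>' j j'. \<rho> $ j $ j' * (env_kraus U b \<nu> \<nu>' $ i $ j * cnj (env_kraus U b \<nu> \<nu>' $ i' $ j'))"
    have "(\<Sum>\<nu>\<in>UNIV. \<Sum>\<nu>'\<in>UNIV. env_kraus U b \<nu> \<nu>' ** \<rho> ** cadjoint (env_kraus U b \<nu> \<nu>')) $ i $ i' =
        (\<Sum>\<nu>\<in>UNIV. \<Sum>\<nu>'\<in>UNIV. \<Sum>j\<in>UNIV. \<Sum>j'\<in>UNIV. ?t \<nu> \<nu>' j j')"
      by (simp add: triple_mult_nth cadjoint_def mult_ac)
    also have "\<dots> = (\<Sum>p\<in>UNIV. \<Sum>q\<in>UNIV. ?t (fst p) (snd p) (fst q) (snd q))"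
      by (simp add: sum_UNIV_prod)
    also have "\<dots> = (\<Sum>q\<in>UNIV. \<Sum>p\<in>UNIV. ?t (fst p) (snd p) (fst q) (snd q))"
      by (rule sum.swap)
    also have "\<dots> = (\<Sum>j\<in>UNIV. \<Sum>j'\<in>UNIV. \<Sum>\<nu>\<in>UNIV. \<Sum>\<nu>'\<in>UNIV. ?t \<nu> \<nu>' j j')"
      by (simp add: sum_UNIV_prod)
    also have "\<dots> = env_channel U \<rho> $ i $ i'"
      unfolding env_channel_nth by (simp only: K sum_distrib_left[symmetric]) (simp add: sum_distrib_left)
    finally show ?thesis .
  qed
  thus ?thesis
    by (simp add: vec_eq_iff)
qed

lemma channel_fidelity_env_channel:
  fixes U :: "('s::finite \<times> 'e::finite) cmat"
  assumes "orthonormal_basis b"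
  shows "channel_fidelity (env_channel U) V =
           1 / (real CARD('s))\<^sup>2 *
             (\<Sum>\<nu>\<in>UNIV. \<Sum>\<nu>'\<in>UNIV. (cmod (trace (cadjoint V ** env_kraus U b \<nu> \<nu>')))\<^sup>2)"
proof -
  obtain ps :: "('e \<times> 'e) list" where ps: "set ps = UNIV" "distinct ps"
    using finite_distinct_list[of "UNIV :: ('e \<times> 'e) set"] by auto
  define Ks where "Ks = map (\<lambda>(\<nu>, \<nu>'). env_kraus U b \<nu> \<nu>') ps"
  have sum_Ks: "(\<Sum>A\<leftarrow>Ks. g A) = (\<Sum>\<nu>\<in>UNIV. \<Sum>\<nu>'\<in>UNIV. g (env_kraus U b \<nu> \<nu>'))"
    for g :: "'s cmat \<Rightarrow> 'z::comm_monoid_add"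
    using ps
    by (simp add: Ks_def o_def case_prod_beta sum_list_distinct_conv_sum_set sum.cartesian_product)
  have "is_kraus (env_channel U) Ks"
    unfolding is_kraus_def sum_Ks using env_channel_kraus[OF assms] by blast
  from channel_fidelity_kraus[OF this, of V] show ?thesis
    unfolding sum_Ks .
qed

end

theory Submission
  imports Defs
begin

text \<open>
  Let \<open>\<Gamma>\<close> be the partial trace over the system of \<open>W = U (V\<^sup>\<dagger> \<otimes> 1)\<close>. Expanding the square, the squared
  distance is \<open>1 - m / n\<close> with \<open>m\<close> the maximum over unitary \<open>\<Phi>\<close> of the real part of \<open>Tr (\<Phi>\<^sup>\<dagger> \<Gamma>)\<close>,
  and the fidelity is \<open>\<parallel>\<Gamma>\<parallel>\<^sup>2 / (n\<^sub>s n)\<close>. The lower bound is the Cauchy-Schwarz inequality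
  \<open>m\<^sup>2 \<le> n\<^sub>e \<parallel>\<Gamma>\<parallel>\<^sup>2\<close> together with \<open>(1 - d)\<^sup>2 \<le> (1 - d\<^sup>2)\<^sup>2\<close>. The upper bound says
  \<open>\<parallel>\<Gamma>\<parallel>\<^sup>2 \<le> n\<^sub>s m\<close>. No polar or singular value decomposition is needed for it: for a maximizer \<open>\<Phi>\<close>,
  comparing with \<open>\<Phi>\<close> times unitary reflections \<open>1 - a v v\<^sup>\<dagger>\<close> shows that \<open>P = \<Phi>\<^sup>\<dagger> \<Gamma>\<close> is positive
  semidefinite; \<open>\<Gamma>\<close> is a sum of \<open>n\<^sub>s\<close> blocks of the unitary \<open>W\<close>, so \<open>P\<close> has operator norm at most \<open>n\<^sub>s\<close>, and hence
  \<open>P\<^sup>2 \<le> n\<^sub>s P\<close>, whose trace is the claim.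
\<close>

section \<open>Real inner products of complex matrices and vectors\<close>

text \<open>Identifies \<open>\<bullet>\<close> on matrices with the real part of the
  Hilbert-Schmidt product, so that Cauchy-Schwarz and bilinearity apply directly.\<close>

lemma inner_cmat: "A \<bullet> B = Re (trace (cadjoint A ** B))" for A B :: "'n::finite cmat"
proof -
  have "A \<bullet> B = (\<Sum>i\<in>UNIV. \<Sum>j\<in>UNIV. Re (cnj (A $ i $ j) * B $ i $ j))"
    by (simp add: inner_vec_def inner_complex_def)
  also have "\<dots> = (\<Sum>j\<in>UNIV. \<Sum>i\<in>UNIV. Re (cnj (A $ i $ j) * B $ i $ j))"
    by (rule sum.swap)
  finally show ?thesis
    by (simp add: trace_def cadjoint_def matrix_matrix_mult_def)
qed

lemma inner_mult_left: "(A ** B) \<bullet> C = B \<bullet> (cadjoint A ** C)" for A B C :: "'n::finite cmat"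
  by (simp add: inner_cmat cadjoint_mult matrix_mul_assoc)

lemma inner_mult_right: "(A ** B) \<bullet> C = A \<bullet> (C ** cadjoint B)" for A B C :: "'n::finite cmat"
  by (simp add: inner_cmat cadjoint_mult matrix_mul_assoc trace_mul_sym[of "cadjoint B ** cadjoint A"])
     (metis matrix_mul_assoc trace_mul_sym)

lemma norm_unitary_sq: "unitary W \<Longrightarrow> (norm W)\<^sup>2 = CARD('n)" for W :: "'n::finite cmat"
  by (simp add: power2_norm_eq_inner inner_cmat unitary_def trace_def mat_def)

lemma norm_unitary_mult: "unitary W \<Longrightarrow> norm (W ** A) = norm A" for W A :: "'n::finite cmat"
  by (simp add: hs_norm_unitary_mult flip: hs_norm_eq_norm)

text \<open>Complements \<open>\<bullet>\<close>, which sees only the real part of the complex inner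
  product.\<close>

definition hdot :: "complex ^ 'n \<Rightarrow> complex ^ 'n::finite \<Rightarrow> complex" where
  "hdot x y = (\<Sum>k\<in>UNIV. cnj (x $ k) * y $ k)"

lemma hdot_self: "hdot x x = of_real ((norm x)\<^sup>2)"
  by (simp add: hdot_def norm_vec_def L2_set_def sum_nonneg complex_norm_square mult.commute
      flip: of_real_power)

lemma Re_hdot: "Re (hdot x y) = x \<bullet> y"
  by (simp add: hdot_def inner_vec_def inner_complex_def)

lemma Im_hdot: "Im (hdot x y) = (\<i> *s x) \<bullet> y"
  by (simp add: hdot_def inner_vec_def inner_complex_def)

lemma inner_matrix_vector_mult: "x \<bullet> (A *v y) = (cadjoint A *v x) \<bullet> y" for A :: "'n::finite cmat"
proof -
  have "hdot x (A *v y) = (\<Sum>k\<in>UNIV. \<Sum>l\<in>UNIV. cnj (x $ k) * (A $ k $ l * y $ l))"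
    by (simp add: hdot_def matrix_vector_mult_def sum_distrib_left)
  also have "\<dots> = (\<Sum>l\<in>UNIV. \<Sum>k\<in>UNIV. cnj (x $ k) * (A $ k $ l * y $ l))"
    by (rule sum.swap)
  also have "\<dots> = hdot (cadjoint A *v x) y"
    by (simp add: hdot_def matrix_vector_mult_def cadjoint_def sum_distrib_left sum_distrib_right mult_ac)
  finally show ?thesis
    by (simp flip: Re_hdot)
qed

lemma norm_unitary_vector_mult: "unitary W \<Longrightarrow> norm (W *v x) = norm x" for W :: "'n::finite cmat"
  by (simp add: norm_eq_sqrt_inner inner_matrix_vector_mult matrix_vector_mul_assoc unitary_def)

section \<open>Unitary reflections\<close>

lemma cadjoint_reflection:
  "cadjoint (mat 1 - ketbra (a *s v) v) = mat 1 - ketbra (cnj a *s v) v"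
  by (simp add: cadjoint_def ketbra_def mat_def vec_eq_iff)

lemma reflection_mult:
  "(mat 1 - ketbra (a *s v) v) ** (mat 1 - ketbra (b *s v) v)
     = mat 1 - ketbra ((a + b - a * b * (norm v)\<^sup>2) *s v) v"
  for v :: "complex ^ 'n::finite"
proof -
  have "(ketbra (a *s v) v ** ketbra (b *s v) v) $ i $ j = a * b * hdot v v * (v $ i * cnj (v $ j))" for i j
    by (simp add: matrix_matrix_mult_def ketbra_def hdot_def sum_distrib_left sum_distrib_right mult_ac)
  hence "ketbra (a *s v) v ** ketbra (b *s v) v = ketbra ((a * b * (norm v)\<^sup>2) *s v) v"
    by (simp add: vec_eq_iff ketbra_def hdot_self mult_ac)
  moreover have "(mat 1 - A) ** (mat 1 - B) = mat 1 - A - B + A ** B" for A B :: "'n cmat"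
  proof -
    have "(mat 1 - A) ** B = mat 1 ** B - A ** B"
      by (simp add: matrix_matrix_mult_def vec_eq_iff left_diff_distrib sum_subtractf)
    thus ?thesis
      by (simp add: matrix_mult_diff_right)
  qed
  moreover have "mat 1 - ketbra (a *s v) v - ketbra (b *s v) v + ketbra (c *s v) v
      = mat 1 - ketbra ((a + b - c) *s v) v" for c
    by (simp add: vec_eq_iff ketbra_def algebra_simps)
  ultimately show ?thesis
    by simp
qed

text \<open>For nonzero \<open>v\<close> the assumption says that the eigenvalue
  \<open>1 - a * (norm v)^2\<close> at \<open>v\<close> has modulus 1; the orthogonal complement of
  \<open>v\<close> is fixed.\<close>

lemma unitary_reflection:
  assumes "2 * Re a = (cmod a)\<^sup>2 * (norm v)\<^sup>2"
  shows "unitary (mat 1 - ketbra (a *s v) v)"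
proof -
  have "a * cnj a = of_real ((cmod a)\<^sup>2)"
    by (simp only: complex_norm_square)
  moreover have "a + cnj a = of_real (2 * Re a)"
    by (rule complex_add_cnj)
  ultimately have "a + cnj a - a * cnj a * (norm v)\<^sup>2 = 0"
    using assms by (simp flip: of_real_mult of_real_power)
  hence "a + cnj a - a * cnj a * (norm v)\<^sup>2 = 0" "cnj a + a - cnj a * a * (norm v)\<^sup>2 = 0"
    by (simp_all add: mult.commute add.commute)
  moreover have "ketbra (0 *s v) v = 0"
    by (simp add: ketbra_def vec_eq_iff)
  ultimately show ?thesis
    unfolding unitary_def cadjoint_reflection reflection_mult by simp
qed

lemma inner_ketbra: "ketbra (a *s v) v \<bullet> P = Re (cnj a * hdot v (P *v v))"
proof -
  have "cnj a * hdot v (P *v v) = (\<Sum>i\<in>UNIV. \<Sum>j\<in>UNIV. cnj (a * (v $ i * cnj (v $ j))) * P $ i $ j)"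
    by (simp add: hdot_def matrix_vector_mult_def sum_distrib_left mult_ac)
  moreover have "x \<bullet> y = Re (cnj x * y)" for x y
    by (simp add: inner_complex_def)
  ultimately show ?thesis
    by (simp only: inner_vec_def ketbra_def vec_lambda_beta vector_smult_component Re_sum mult.assoc)
qed

section \<open>Positivity at a maximizer\<close>

lemma hdot_nonneg_if_identity_optimal:
  fixes P :: "'n::finite cmat"
  assumes opt: "\<And>\<Psi>. unitary \<Psi> \<Longrightarrow> \<Psi> \<bullet> P \<le> mat 1 \<bullet> P"
  shows "hdot v (P *v v) = of_real (cmod (hdot v (P *v v)))"
proof (cases "hdot v (P *v v) = 0")
  case False
  define z where "z = hdot v (P *v v)"
  \<comment> \<open>The reflection below multiplies \<open>v\<close> by the phase of \<open>z\<close>, so optimality gives \<open>\<bar>z\<bar> \<le> Re z\<close>.\<close>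
  define w where "w = z / cmod z"
  define a where "a = (1 - w) / (norm v)\<^sup>2"
  have "v \<noteq> 0"
    using False by (auto simp: hdot_def)
  hence v: "norm v \<noteq> 0"
    by simp
  have z: "cmod z \<noteq> 0"
    using False by (simp add: z_def)
  have w: "cmod w = 1"
    using z by (simp add: w_def norm_divide)
  \<comment> \<open>Holds as \<open>w\<close> has modulus 1; dividing by \<open>(norm v)^2\<close>
    gives the unitarity condition for \<open>a\<close>.\<close>
  have "(cmod (1 - w))\<^sup>2 = 2 * Re (1 - w)"
    using cmod_power2[of w] cmod_power2[of "1 - w"] w by (simp add: power2_eq_square algebra_simps)
  hence "2 * Re a = (cmod a)\<^sup>2 * (norm v)\<^sup>2"
    using v by (simp add: a_def norm_divide norm_power Re_divide_of_real power_divide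
        flip: of_real_power) (simp add: divide_simps eval_nat_numeral)
  from opt[OF unitary_reflection[OF this]] have "0 \<le> Re (cnj a * z)"
    by (simp add: inner_diff_left inner_ketbra z_def)
  moreover have "cnj w * z = of_real (cmod z)"
  proof -
    have "cnj z * z = of_real (cmod z) * of_real (cmod z)"
      by (metis complex_norm_square mult.commute of_real_power power2_eq_square)
    thus ?thesis
      using z by (simp add: w_def)
  qed
  hence "cnj a * z = (z - of_real (cmod z)) / of_real ((norm v)\<^sup>2)"
    by (simp add: a_def left_diff_distrib)
  hence "Re (cnj a * z) = (Re z - cmod z) / (norm v)\<^sup>2"
    by (simp add: Re_divide_of_real flip: of_real_power)
  ultimately have "cmod z \<le> Re z"
    using v by (simp add: zero_le_divide_iff)
  hence "Re z = cmod z"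
    using complex_Re_le_cmod[of z] by simp
  moreover from this have "Im z = 0"
    using cmod_power2[of z] by simp
  ultimately show ?thesis
    unfolding z_def[symmetric] by (simp add: complex_eq_iff)
qed simp

text \<open>This is \<open>f^2 \<le> c f\<close> for a symmetric \<open>f\<close> with spectrum
  between 0 and \<open>c\<close>, obtained without diagonalizing: positivity is tested at
  \<open>c y - f y\<close>, and the cubic term is absorbed by the norm bound.\<close>

lemma norm_sq_le_inner_if_psd:
  fixes f :: "'a::real_inner \<Rightarrow> 'a"
  assumes "linear f" and sym: "\<And>x y. x \<bullet> f y = f x \<bullet> y" and psd: "\<And>x. 0 \<le> x \<bullet> f x"
    and bound: "\<And>x. norm (f x) \<le> c * norm x" and "0 < c"
  shows "(norm (f y))\<^sup>2 \<le> c * (y \<bullet> f y)"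
proof -
  interpret linear f by fact
  have "f y \<bullet> f (f y) \<le> norm (f y) * (c * norm (f y))"
    by (rule order_trans[OF norm_cauchy_schwarz mult_left_mono[OF bound]]) simp
  hence le: "f y \<bullet> f (f y) \<le> c * (norm (f y))\<^sup>2"
    by (simp add: power2_eq_square mult_ac)
  have "0 \<le> (c *\<^sub>R y - f y) \<bullet> f (c *\<^sub>R y - f y)"
    by (rule psd)
  also have "\<dots> = c * (c * (y \<bullet> f y)) - 2 * c * (norm (f y))\<^sup>2 + f y \<bullet> f (f y)"
    by (simp add: diff scale inner_diff sym[of y "f y"] algebra_simps power2_norm_eq_inner)
  also have "\<dots> \<le> c * (c * (y \<bullet> f y)) - c * (norm (f y))\<^sup>2"
    using le by simp
  finally have "c * (norm (f y))\<^sup>2 \<le> c * (c * (y \<bullet> f y))"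
    by simp
  with \<open>0 < c\<close> show ?thesis
    by simp
qed

text \<open>Optimality makes \<open>P\<close> symmetric and positive, so the previous bound holds at
  each standard basis vector. Summed over the basis, its two sides become the squared norm of
  \<open>P\<close> and \<open>c\<close> times the real part of its trace.\<close>

lemma norm_sq_le_if_identity_optimal:
  fixes P :: "'n::finite cmat"
  assumes opt: "\<And>\<Psi>. unitary \<Psi> \<Longrightarrow> \<Psi> \<bullet> P \<le> mat 1 \<bullet> P"
    and bound: "\<And>x. norm (P *v x) \<le> c * norm x" and "0 < c"
  shows "(norm P)\<^sup>2 \<le> c * (mat 1 \<bullet> P)"
proof -
  have real: "hdot x (P *v x) = of_real (cmod (hdot x (P *v x)))" for x
    by (rule hdot_nonneg_if_identity_optimal[OF opt])
  have nonneg: "0 \<le> x \<bullet> (P *v x)" for x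
    by (subst Re_hdot[symmetric], subst real) simp
  have im: "(\<i> *s x) \<bullet> (P *v x) = 0" for x
    by (subst Im_hdot[symmetric], subst real) simp
  \<comment> \<open>Real symmetry by polarization: the quadratic form of \<open>P\<close> has no imaginary part.\<close>
  have skew: "(\<i> *s x) \<bullet> (P *v y) + (\<i> *s y) \<bullet> (P *v x) = 0" for x y
    using im[of "x + y"] im[of x] im[of y]
    by (simp add: matrix_vector_right_distrib vec.scale_right_distrib inner_add)
  have sym: "x \<bullet> (P *v y) = (P *v x) \<bullet> y" for x y
  proof -
    \<comment> \<open>Replacing \<open>y\<close> by \<open>\<i> *s y\<close> turns the skew relation
      into symmetry.\<close>
    have "P *v (\<i> *s y) = \<i> *s (P *v y)"
      by (simp add: matrix_vector_mult_def vec_eq_iff sum_distrib_left mult_ac)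
    moreover have "(\<i> *s a) \<bullet> (\<i> *s b) = a \<bullet> b" for a b :: "complex ^ 'n"
      by (simp add: inner_vec_def inner_complex_def add.commute)
    moreover have "\<i> *s (\<i> *s y) = - y"
      by (simp add: vec_eq_iff)
    ultimately show ?thesis
      using skew[of x "\<i> *s y"] by (simp add: inner_commute)
  qed
  have lin: "linear (\<lambda>x. P *v x)"
    by (rule linearI)
       (simp_all add: matrix_vector_right_distrib, simp add: matrix_vector_mult_def vec_eq_iff scaleR_sum_right)
  have col: "P *v axis j 1 = column j P" for j
    by (simp add: matrix_vector_mult_def axis_def column_def vec_eq_iff if_distrib cong: if_cong)
  have "(norm P)\<^sup>2 = (\<Sum>i\<in>UNIV. \<Sum>j\<in>UNIV. P $ i $ j \<bullet> P $ i $ j)"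
    by (simp add: power2_norm_eq_inner inner_vec_def)
  also have "\<dots> = (\<Sum>j\<in>UNIV. \<Sum>i\<in>UNIV. P $ i $ j \<bullet> P $ i $ j)"
    by (rule sum.swap)
  also have "\<dots> = (\<Sum>j\<in>UNIV. (norm (P *v axis j 1))\<^sup>2)"
    by (simp add: power2_norm_eq_inner inner_vec_def col column_def)
  also have "\<dots> \<le> (\<Sum>j\<in>UNIV. c * (axis j 1 \<bullet> (P *v axis j 1)))"
    by (intro sum_mono norm_sq_le_inner_if_psd lin sym nonneg bound \<open>0 < c\<close>)
  also have "\<dots> = c * (mat 1 \<bullet> P)"
    by (simp add: col column_def inner_axis' inner_cmat trace_def inner_complex_def flip: sum_distrib_left)
  finally show ?thesis .
qed

section \<open>The partial trace over the system\<close>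

definition ptrace_sys :: "('s::finite \<times> 'e::finite) cmat \<Rightarrow> 'e cmat" where
  "ptrace_sys M = (\<chi> k l. \<Sum>i\<in>UNIV. M $ (i, k) $ (i, l))"

text \<open>The partial trace is adjoint to tensoring with the identity; this moves the minimization
  over \<open>\<Phi>\<close> to the environment.\<close>

lemma inner_mat_1_tensor: "(mat 1 \<otimes>\<^sub>c \<Phi>) \<bullet> W = \<Phi> \<bullet> ptrace_sys W"
  for W :: "('s::finite \<times> 'e::finite) cmat"
proof -
  have "((mat 1 \<otimes>\<^sub>c \<Phi>) $ (i, k) $ (j, l)) \<bullet> (W $ (i, k) $ (j, l))
      = (if j = i then \<Phi> $ k $ l \<bullet> W $ (i, k) $ (i, l) else 0)" for i j k l
    by (simp add: tensor_def mat_def)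
  hence "(mat 1 \<otimes>\<^sub>c \<Phi>) \<bullet> W
      = (\<Sum>i\<in>UNIV. \<Sum>k\<in>UNIV. \<Sum>j\<in>UNIV. \<Sum>l\<in>UNIV. if j = i then \<Phi> $ k $ l \<bullet> W $ (i, k) $ (i, l) else 0)"
    by (simp only: inner_vec_def[where ?'b = "'s \<times> 'e"] sum_UNIV_prod)
  also have "\<dots> = (\<Sum>i\<in>UNIV. \<Sum>k\<in>UNIV. \<Sum>l\<in>UNIV. \<Sum>j\<in>UNIV. if j = i then \<Phi> $ k $ l \<bullet> W $ (i, k) $ (i, l) else 0)"
    by (intro sum.cong refl sum.swap)
  also have "\<dots> = (\<Sum>i\<in>UNIV. \<Sum>k\<in>UNIV. \<Sum>l\<in>UNIV. \<Phi> $ k $ l \<bullet> W $ (i, k) $ (i, l))"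
    by simp
  also have "\<dots> = (\<Sum>k\<in>UNIV. \<Sum>i\<in>UNIV. \<Sum>l\<in>UNIV. \<Phi> $ k $ l \<bullet> W $ (i, k) $ (i, l))"
    by (rule sum.swap)
  also have "\<dots> = (\<Sum>k\<in>UNIV. \<Sum>l\<in>UNIV. \<Sum>i\<in>UNIV. \<Phi> $ k $ l \<bullet> W $ (i, k) $ (i, l))"
    by (intro sum.cong refl sum.swap)
  also have "\<dots> = \<Phi> \<bullet> ptrace_sys W"
    by (simp add: inner_vec_def ptrace_sys_def inner_sum_right)
  finally show ?thesis .
qed

lemma norm_ptrace_sys_unitary_le:
  fixes W :: "('s::finite \<times> 'e::finite) cmat"
  assumes "unitary W"
  shows "norm (ptrace_sys W *v x) \<le> CARD('s) * norm x"
proof -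
  \<comment> \<open>\<open>X i\<close> is the tensor product of the basis vector \<open>i\<close>
    with \<open>x\<close>. Below, \<open>Y i\<close> is the diagonal block \<open>(i, i)\<close> of
    \<open>W\<close> applied to \<open>x\<close>, a compression of a unitary and hence of norm at
    most \<open>norm x\<close>.\<close>
  define X :: "'s \<Rightarrow> complex ^ ('s \<times> 'e)" where "X i = (\<chi> p. if fst p = i then x $ snd p else 0)" for i
  have normX: "(norm (X i))\<^sup>2 = (norm x)\<^sup>2" for i
  proof -
    have "(norm (X i))\<^sup>2 = (\<Sum>j\<in>UNIV. if j = i then \<Sum>k\<in>UNIV. x $ k \<bullet> x $ k else 0)"
      unfolding power2_norm_eq_inner inner_vec_def sum_UNIV_prod
      by (intro sum.cong) (simp_all add: X_def)
    thus ?thesis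
      by (simp add: power2_norm_eq_inner inner_vec_def)
  qed
  define Y :: "'s \<Rightarrow> complex ^ 'e" where "Y i = (\<chi> k. (W *v X i) $ (i, k))" for i
  have Y: "norm (Y i) \<le> norm x" for i
  proof -
    have "(norm (Y i))\<^sup>2 = (\<Sum>j\<in>{i}. \<Sum>k\<in>UNIV. (W *v X i) $ (j, k) \<bullet> (W *v X i) $ (j, k))"
      by (simp add: power2_norm_eq_inner inner_vec_def Y_def)
    also have "\<dots> \<le> (\<Sum>j\<in>UNIV. \<Sum>k\<in>UNIV. (W *v X i) $ (j, k) \<bullet> (W *v X i) $ (j, k))"
      by (intro sum_mono2 sum_nonneg) simp_all
    also have "\<dots> = (norm (W *v X i))\<^sup>2"
      by (simp add: power2_norm_eq_inner inner_vec_def[where ?'b = "'s \<times> 'e"] sum_UNIV_prod)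
    also have "\<dots> = (norm x)\<^sup>2"
      using assms by (simp add: norm_unitary_vector_mult normX)
    finally show ?thesis
      by (rule power2_le_imp_le) simp
  qed
  have "Y i $ k = (\<Sum>l\<in>UNIV. W $ (i, k) $ (i, l) * x $ l)" for i k
  proof -
    have "Y i $ k = (\<Sum>j\<in>UNIV. if j = i then \<Sum>l\<in>UNIV. W $ (i, k) $ (i, l) * x $ l else 0)"
      unfolding Y_def matrix_vector_mult_def vec_lambda_beta sum_UNIV_prod
      by (intro sum.cong) (simp_all add: X_def)
    thus ?thesis
      by simp
  qed
  hence "(ptrace_sys W *v x) $ k = (\<Sum>i\<in>UNIV. Y i $ k)" for k
    by (simp add: ptrace_sys_def matrix_vector_mult_def sum_distrib_right) (rule sum.swap)
  hence "ptrace_sys W *v x = (\<Sum>i\<in>UNIV. Y i)"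
    by (simp add: vec_eq_iff)
  moreover have "norm (\<Sum>i\<in>UNIV. Y i) \<le> (\<Sum>i\<in>(UNIV::'s set). norm x)"
    by (intro sum_norm_le Y)
  ultimately show ?thesis
    by simp
qed

section \<open>Distance and fidelity in terms of \<open>\<Gamma>\<close>\<close>

lemma hs_norm_sq_diff_unitary:
  fixes U W :: "'n::finite cmat"
  assumes "unitary U" "unitary W"
  shows "(hs_norm (U - W))\<^sup>2 = 2 * CARD('n) - 2 * (W \<bullet> U)"
  using norm_unitary_sq[OF assms(1)] norm_unitary_sq[OF assms(2)]
  by (simp add: hs_norm_eq_norm power2_norm_eq_inner inner_diff inner_commute)

text \<open>In the standard basis the Kraus operators are rescaled blocks of \<open>U\<close>, and
  their traces against the adjoint of \<open>V\<close> are the entries of the partial trace, up to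
  the same factor.\<close>

lemma channel_fidelity_ptrace_sys:
  fixes U :: "('s::finite \<times> 'e::finite) cmat"
  shows "channel_fidelity (env_channel U) V
           = (norm (ptrace_sys (U ** (cadjoint V \<otimes>\<^sub>c mat 1))))\<^sup>2 / (CARD('s) * real (CARD('s) * CARD('e)))"
proof -
  let ?G = "ptrace_sys (U ** (cadjoint V \<otimes>\<^sub>c mat 1)) :: 'e cmat"
  let ?b = "\<lambda>\<nu>. axis \<nu> 1 :: complex ^ 'e"
  have b: "orthonormal_basis ?b"
    unfolding orthonormal_basis_def
  proof (intro allI)
    fix \<nu> \<nu>' :: 'e
    have "(\<Sum>k\<in>UNIV. cnj (?b \<nu> $ k) * ?b \<nu>' $ k) = (\<Sum>k\<in>UNIV. if k = \<nu> then ?b \<nu>' $ k else 0)"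
      by (intro sum.cong) (simp_all add: axis_def)
    thus "(\<Sum>k\<in>UNIV. cnj (?b \<nu> $ k) * ?b \<nu>' $ k) = (if \<nu> = \<nu>' then 1 else 0)"
      by (simp add: axis_def)
  qed
  have K: "env_kraus U ?b \<nu> \<nu>' $ i $ j = 1 / of_real (sqrt (real CARD('e))) * U $ (i, \<nu>) $ (j, \<nu>')" for \<nu> \<nu>' i j
    by (simp add: env_kraus_nth axis_def if_distrib if_distribR cong: if_cong)
  have G: "?G $ \<nu> $ \<nu>' = (\<Sum>i\<in>UNIV. \<Sum>j\<in>UNIV. cnj (V $ i $ j) * U $ (i, \<nu>) $ (j, \<nu>'))" for \<nu> \<nu>'
  proof -
    have "(U ** (cadjoint V \<otimes>\<^sub>c mat 1)) $ (i, \<nu>) $ (i, \<nu>')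
        = (\<Sum>j\<in>UNIV. \<Sum>k\<in>UNIV. if k = \<nu>' then cnj (V $ i $ j) * U $ (i, \<nu>) $ (j, \<nu>') else 0)" for i
      unfolding matrix_matrix_mult_def vec_lambda_beta sum_UNIV_prod
      by (intro sum.cong) (auto simp: tensor_def mat_def cadjoint_def)
    thus ?thesis
      by (simp add: ptrace_sys_def)
  qed
  have "trace (cadjoint V ** env_kraus U ?b \<nu> \<nu>') = 1 / of_real (sqrt (real CARD('e))) * ?G $ \<nu> $ \<nu>'" for \<nu> \<nu>'
  proof -
    have "trace (cadjoint V ** env_kraus U ?b \<nu> \<nu>')
        = 1 / of_real (sqrt (real CARD('e))) * (\<Sum>j\<in>UNIV. \<Sum>i\<in>UNIV. cnj (V $ i $ j) * U $ (i, \<nu>) $ (j, \<nu>'))"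
      by (simp add: trace_def cadjoint_def matrix_matrix_mult_def K sum_distrib_left mult_ac)
    also have "(\<Sum>j\<in>UNIV. \<Sum>i\<in>UNIV. cnj (V $ i $ j) * U $ (i, \<nu>) $ (j, \<nu>')) = ?G $ \<nu> $ \<nu>'"
      unfolding G by (rule sum.swap)
    finally show ?thesis .
  qed
  hence "(cmod (trace (cadjoint V ** env_kraus U ?b \<nu> \<nu>')))\<^sup>2 = (cmod (?G $ \<nu> $ \<nu>'))\<^sup>2 / CARD('e)" for \<nu> \<nu>'
    by (simp add: norm_mult norm_divide power_divide)
  moreover have "(norm ?G)\<^sup>2 = (\<Sum>\<nu>\<in>UNIV. \<Sum>\<nu>'\<in>UNIV. (cmod (?G $ \<nu> $ \<nu>'))\<^sup>2)"
    by (simp add: power2_norm_eq_inner inner_vec_def)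
  ultimately show ?thesis
    by (simp add: channel_fidelity_env_channel[OF b] power2_eq_square mult_ac flip: sum_divide_distrib)
qed

theorem mainTheorem3:
  fixes U :: "('s::finite \<times> 'e::finite) cmat" and V :: "'s cmat"
  assumes "unitary U" and "unitary V"
  shows "(1 - env_dist (env_class U) (env_class (V \<otimes>\<^sub>c mat 1)))\<^sup>2
           \<le> channel_fidelity (env_channel U) V
       \<and> channel_fidelity (env_channel U) V
           \<le> 1 - (env_dist (env_class U) (env_class (V \<otimes>\<^sub>c mat 1)))\<^sup>2"
proof -
  define W where "W = U ** (cadjoint V \<otimes>\<^sub>c mat 1 :: ('s \<times> 'e) cmat)"
  define \<Gamma> where "\<Gamma> = ptrace_sys W"
  define m where "m = env_min U (V \<otimes>\<^sub>c (mat 1 :: 'e cmat))"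
  define d where "d = env_dist (env_class U) (env_class (V \<otimes>\<^sub>c (mat 1 :: 'e cmat)))"
  let ?s = "real CARD('s)" and ?e = "real CARD('e)"
  have pos: "0 < ?s" "0 < ?e"
    by simp_all
  have W: "unitary W"
    unfolding W_def by (intro unitary_mult unitary_tensor unitary_cadjoint assms unitary_mat_1)
  \<comment> \<open>Moving \<open>V\<close> across the inner product turns \<open>U\<close> into
    \<open>W\<close>, and the partial trace then turns \<open>W\<close> into
    \<open>\<Gamma>\<close>.\<close>
  have dist: "(hs_norm (U - (mat 1 \<otimes>\<^sub>c \<Phi>) ** (V \<otimes>\<^sub>c mat 1)))\<^sup>2 = 2 * (?s * ?e) - 2 * (\<Phi> \<bullet> \<Gamma>)"
    if "unitary \<Phi>" for \<Phi> :: "'e cmat"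
    using hs_norm_sq_diff_unitary[OF assms(1), of "(mat 1 \<otimes>\<^sub>c \<Phi>) ** (V \<otimes>\<^sub>c mat 1)"] that assms
    by (simp add: unitary_mult unitary_tensor inner_mult_right cadjoint_tensor inner_mat_1_tensor W_def \<Gamma>_def)
  obtain \<Phi> :: "'e cmat" where \<Phi>: "unitary \<Phi>" and m: "hs_norm (U - (mat 1 \<otimes>\<^sub>c \<Phi>) ** (V \<otimes>\<^sub>c mat 1)) = m"
    and min: "\<And>\<Psi>. unitary \<Psi> \<Longrightarrow> m \<le> hs_norm (U - (mat 1 \<otimes>\<^sub>c \<Psi>) ** (V \<otimes>\<^sub>c mat 1))"
    unfolding m_def using env_min_attained[of U "V \<otimes>\<^sub>c (mat 1 :: 'e cmat)"] by blast
  have m0: "0 \<le> m"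
    unfolding m[symmetric] by (simp add: hs_norm_eq_norm)
  have opt: "\<Psi> \<bullet> \<Gamma> \<le> \<Phi> \<bullet> \<Gamma>" if "unitary \<Psi>" for \<Psi>
    using power_mono[OF min[OF that] m0, of 2] dist[OF that] dist[OF \<Phi>] m by simp
  have d: "d = 1 / sqrt (2 * (?s * ?e)) * m"
    unfolding d_def m_def by (simp add: env_dist_env_class)
  have d0: "0 \<le> d"
    unfolding d using m0 by simp
  have "d\<^sup>2 = m\<^sup>2 / (2 * (?s * ?e))"
    by (simp add: d power_mult_distrib power_divide real_sqrt_mult)
  also have "m\<^sup>2 = 2 * (?s * ?e) - 2 * (\<Phi> \<bullet> \<Gamma>)"
    using dist[OF \<Phi>] m by simp
  finally have d2: "1 - d\<^sup>2 = (\<Phi> \<bullet> \<Gamma>) / (?s * ?e)"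
    using pos by (simp add: field_simps)
  have F: "channel_fidelity (env_channel U) V = (norm \<Gamma>)\<^sup>2 / (?s * (?s * ?e))"
    by (simp add: channel_fidelity_ptrace_sys W_def \<Gamma>_def)

  \<comment> \<open>Translation by the adjoint of \<open>\<Phi>\<close> moves the maximizer to the
    identity and preserves the norm.\<close>
  define P where "P = cadjoint \<Phi> ** \<Gamma>"
  have "(norm P)\<^sup>2 \<le> ?s * (mat 1 \<bullet> P)"
  proof (rule norm_sq_le_if_identity_optimal)
    show "\<Psi> \<bullet> P \<le> mat 1 \<bullet> P" if "unitary \<Psi>" for \<Psi>
      using opt[OF unitary_mult[OF \<Phi> that]] inner_mult_left[of \<Phi> "mat 1" \<Gamma>]
      by (simp add: P_def inner_mult_left)
    show "norm (P *v x) \<le> ?s * norm x" for x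
      using norm_ptrace_sys_unitary_le[OF W, of x]
      by (simp add: P_def \<Gamma>_def norm_unitary_vector_mult[OF unitary_cadjoint[OF \<Phi>]]
          flip: matrix_vector_mul_assoc)
  qed simp
  hence upper: "(norm \<Gamma>)\<^sup>2 \<le> ?s * (\<Phi> \<bullet> \<Gamma>)"
    using inner_mult_left[of \<Phi> "mat 1" \<Gamma>] by (simp add: P_def norm_unitary_mult unitary_cadjoint \<Phi>)

  have "(\<Phi> \<bullet> \<Gamma>)\<^sup>2 \<le> (norm \<Phi>)\<^sup>2 * (norm \<Gamma>)\<^sup>2"
    using Cauchy_Schwarz_ineq[of \<Phi> \<Gamma>] by (simp add: power2_norm_eq_inner)
  hence lower: "(\<Phi> \<bullet> \<Gamma>)\<^sup>2 \<le> ?e * (norm \<Gamma>)\<^sup>2"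
    using norm_unitary_sq[OF \<Phi>] by simp

  \<comment> \<open>The factor \<open>(1 + d)^2\<close> is at least 1 by \<open>d0\<close> and
    completes \<open>1 - d\<close> to \<open>1 - d^2\<close>, which \<open>d2\<close>
    evaluates.\<close>
  have "(1 - d)\<^sup>2 * 1 \<le> (1 - d)\<^sup>2 * (1 + d)\<^sup>2"
    using d0 by (intro mult_left_mono one_le_power) simp_all
  also have "\<dots> = (1 - d\<^sup>2)\<^sup>2"
    by (simp add: power2_eq_square algebra_simps)
  also have "\<dots> = (\<Phi> \<bullet> \<Gamma>)\<^sup>2 / (?s * ?e)\<^sup>2"
    by (simp only: d2 power_divide)
  also have "\<dots> \<le> ?e * (norm \<Gamma>)\<^sup>2 / (?s * ?e)\<^sup>2"
    by (intro divide_right_mono lower) simp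
  also have "\<dots> = (norm \<Gamma>)\<^sup>2 / (?s * (?s * ?e))"
    using pos by (simp add: power2_eq_square)
  finally have "(1 - d)\<^sup>2 \<le> channel_fidelity (env_channel U) V"
    by (simp add: F)
  moreover have "channel_fidelity (env_channel U) V \<le> 1 - d\<^sup>2"
  proof -
    have "(norm \<Gamma>)\<^sup>2 / (?s * (?s * ?e)) \<le> ?s * (\<Phi> \<bullet> \<Gamma>) / (?s * (?s * ?e))"
      by (intro divide_right_mono upper) simp
    thus ?thesis
      using pos by (simp add: F d2)
  qed
  ultimately show ?thesis
    by (simp only: d_def)
qed

end
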